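(* Let $(X,b)$ be a connected weighted graph satisfying a global Poincaré inequality, i.e. there is $c>0$ with $\|f\|_{\mathcal V}^2\le c\,\mathcal E(f)$ for all $f\in\mathcal D$. Then the best possible (smallest) constant $c_P$ in this inequality satisfies $$\frac{4}{c_P}=\inf_m\{\text{second lowest eigenvalue of }H^{(N)}_m\},$$ where the infimum runs over all probability measures $m$ on $X$ of full support.
   Context: A weighted graph $(X,b)$ consists of a countable (finite or infinite) set $X$ and a symmetric function $b:X\times X\to[0,\infty)$ with $b(x,x)=0$ for all $x\in X$ (no summability or local finiteness is assumed). It is connected if any two points $x,y\in X$ are joined by a path, i.e. for $x\neq y$ there are $x=x_0,x_1,\dots,x_k=y$ with $b(x_j,x_{j+1})>0$ for $0\le j<k$. Let $\mathcal D=\{f:X\to\mathbb R\mid \sum_{x,y\in X}b(x,y)|f(x)-f(y)|^2<\infty\}$ and $\mathcal E(f,g)=\frac12\sum_{x,y\in X}b(x,y)(f(x)-f(y))(g(x)-g(y))$, $\mathcal E(f)=\mathcal E(f,f)$, for $f,g\in\mathcal D$. For $f:X\to\mathbb R$ put $\|f\|_{\mathcal V}=\sup f-\inf f\in[0,\infty]$. A measure $m$ on $X$ has full support if $m(x):=m(\{x\})>0$ for all $x\in X$; $\ell^2(X,m)=\{f:X\to\mathbb R\mid\|f\|_2^2=\sum_x|f(x)|^2m(x)<\infty\}$. $\mathcal E^{(N)}$ is the restriction of $\mathcal E$ to $\mathcal D\cap\ell^2(X,m)$; it is a closed form on $\ell^2(X,m)$, not necessarily densely defined. $H_m^{(N)}$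 is the associated selfadjoint operator in the Hilbert space obtained as the closure of $\mathcal D\cap\ell^2(X,m)$ in $\ell^2(X,m)$. Under a global Poincaré inequality and for a probability measure $m$, $H_m^{(N)}$ has pure point spectrum; the infimum of its spectrum is $0$, with the constant functions being eigenfunctions. *)

theory Defs
  imports "HOL-Probability.Probability"
begin

(* The countable vertex set X is a (nonempty) type 'a :: countable. *)

definition weighted_graph :: "('a::countable \<Rightarrow> 'a \<Rightarrow> real) \<Rightarrow> bool" where
  "weighted_graph b \<longleftrightarrow>
     (\<forall>x y. 0 \<le> b x y) \<and> (\<forall>x y. b x y = b y x) \<and> (\<forall>x. b x x = 0)"

definition connected_graph :: "('a::countable \<Rightarrow> 'a \<Rightarrow> real) \<Rightarrow> bool" where
  "connected_graph b \<longleftrightarrow> (\<forall>x y. rtranclp (\<lambda>u v. 0 < b u v) x y)"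

definition finite_energy :: "('a::countable \<Rightarrow> 'a \<Rightarrow> real) \<Rightarrow> ('a \<Rightarrow> real) set" where
  "finite_energy b = {f. (\<lambda>(x, y). b x y * (f x - f y)\<^sup>2) summable_on UNIV}"

definition energy ::
    "('a::countable \<Rightarrow> 'a \<Rightarrow> real) \<Rightarrow> ('a \<Rightarrow> real) \<Rightarrow> ('a \<Rightarrow> real) \<Rightarrow> real" where
  "energy b f g = (\<Sum>\<^sub>\<infinity>(x, y)\<in>UNIV. b x y * (f x - f y) * (g x - g y)) / 2"

definition variation :: "('a \<Rightarrow> real) \<Rightarrow> ereal" where
  "variation f = (SUP x. ereal (f x)) - (INF x. ereal (f x))"

definition global_poincare :: "('a::countable \<Rightarrow> 'a \<Rightarrow> real) \<Rightarrow> real \<Rightarrow> bool" where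
  "global_poincare b c \<longleftrightarrow>
     (\<forall>f\<in>finite_energy b. (variation f)\<^sup>2 \<le> ereal (c * energy b f f))"

(* If all functions of finite energy are constant, every c > 0 is admissible and the
   value is 0; otherwise the value is positive. *)
definition poincare_constant :: "('a::countable \<Rightarrow> 'a \<Rightarrow> real) \<Rightarrow> real" where
  "poincare_constant b = Inf {c. 0 \<le> c \<and> global_poincare b c}"

(* A measure m of full support on the discrete space X is given by its weights
   m x = m({x}) > 0. *)

definition ell2 :: "('a::countable \<Rightarrow> real) \<Rightarrow> ('a \<Rightarrow> real) set" where
  "ell2 m = {f. (\<lambda>x. (f x)\<^sup>2 * m x) summable_on UNIV}"

definition ell2_inner ::
    "('a::countable \<Rightarrow> real) \<Rightarrow> ('a \<Rightarrow> real) \<Rightarrow> ('a \<Rightarrow> real) \<Rightarrow> real" where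
  "ell2_inner m f g = (\<Sum>\<^sub>\<infinity>x. f x * g x * m x)"

definition ell2_norm :: "('a::countable \<Rightarrow> real) \<Rightarrow> ('a \<Rightarrow> real) \<Rightarrow> real" where
  "ell2_norm m f = sqrt (ell2_inner m f f)"

definition neumann_form_domain ::
    "('a::countable \<Rightarrow> 'a \<Rightarrow> real) \<Rightarrow> ('a \<Rightarrow> real) \<Rightarrow> ('a \<Rightarrow> real) set" where
  "neumann_form_domain b m = finite_energy b \<inter> ell2 m"

definition neumann_space ::
    "('a::countable \<Rightarrow> 'a \<Rightarrow> real) \<Rightarrow> ('a \<Rightarrow> real) \<Rightarrow> ('a \<Rightarrow> real) set" where
  "neumann_space b m =
     {g \<in> ell2 m. \<forall>e>0. \<exists>h\<in>neumann_form_domain b m. ell2_norm m (\<lambda>x. g x - h x) < e}"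

(* The operator associated with the closed form energy b on neumann_form_domain b m, acting
   in the Hilbert space neumann_space b m: f is in its domain with image g iff
   energy b f h = <g, h> for all h in the form domain. By density of the form domain
   in neumann_space b m there is at most one such g. *)
definition represents_form ::
    "('a::countable \<Rightarrow> 'a \<Rightarrow> real) \<Rightarrow> ('a \<Rightarrow> real) \<Rightarrow> ('a \<Rightarrow> real) \<Rightarrow> ('a \<Rightarrow> real) \<Rightarrow> bool" where
  "represents_form b m f g \<longleftrightarrow> g \<in> neumann_space b m \<and>
     (\<forall>h\<in>neumann_form_domain b m. energy b f h = ell2_inner m g h)"

definition neumann_domain ::
    "('a::countable \<Rightarrow> 'a \<Rightarrow> real) \<Rightarrow> ('a \<Rightarrow> real) \<Rightarrow> ('a \<Rightarrow> real) set" where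
  "neumann_domain b m = {f \<in> neumann_form_domain b m. \<exists>g. represents_form b m f g}"

definition neumann_laplacian ::
    "('a::countable \<Rightarrow> 'a \<Rightarrow> real) \<Rightarrow> ('a \<Rightarrow> real) \<Rightarrow> ('a \<Rightarrow> real) \<Rightarrow> ('a \<Rightarrow> real)" where
  "neumann_laplacian b m f = (THE g. represents_form b m f g)"

definition neumann_eigenvalues ::
    "('a::countable \<Rightarrow> 'a \<Rightarrow> real) \<Rightarrow> ('a \<Rightarrow> real) \<Rightarrow> real set" where
  "neumann_eigenvalues b m =
     {l. \<exists>f\<in>neumann_domain b m. f \<noteq> (\<lambda>_. 0) \<and> neumann_laplacian b m f = (\<lambda>x. l * f x)}"

definition is_lowest :: "real set \<Rightarrow> real \<Rightarrow> bool" where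
  "is_lowest S l \<longleftrightarrow> l \<in> S \<and> (\<forall>k\<in>S. l \<le> k)"

(* Eigenvalues are taken without multiplicity. On a connected graph only constants have
   zero energy, so the lowest eigenvalue 0 is simple and counting with multiplicity
   gives the same second eigenvalue. *)
definition is_second_lowest_eigenvalue ::
    "('a::countable \<Rightarrow> 'a \<Rightarrow> real) \<Rightarrow> ('a \<Rightarrow> real) \<Rightarrow> real \<Rightarrow> bool" where
  "is_second_lowest_eigenvalue b m l \<longleftrightarrow>
     (\<exists>l0. is_lowest (neumann_eigenvalues b m) l0 \<and>
           is_lowest (neumann_eigenvalues b m - {l0}) l)"

(* Under a global Poincare inequality and for a probability measure of full support, the
   value infinity occurs only if the Hilbert space consists of the constants alone. *)
definition second_lowest_eigenvalue ::
    "('a::countable \<Rightarrow> 'a \<Rightarrow> real) \<Rightarrow> ('a \<Rightarrow> real) \<Rightarrow> ereal" where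
  "second_lowest_eigenvalue b m =
     (if \<exists>l. is_second_lowest_eigenvalue b m l
      then ereal (THE l. is_second_lowest_eigenvalue b m l) else \<infinity>)"

end

theory Submission
  imports Defs
begin

text \<open>
  If \<open>f\<close> is an eigenfunction for an eigenvalue \<open>l \<noteq> 0\<close>, then \<open>f\<close> has mean zero, so Popoviciu's
  inequality for the variance and the Poincare inequality give
  \<open>\<parallel>f\<parallel>\<^sup>2 \<le> \<parallel>f\<parallel>\<^sub>V\<^sup>2 / 4 \<le> c\<^sub>P l \<parallel>f\<parallel>\<^sup>2 / 4\<close>, i.e. \<open>4 / c\<^sub>P \<le> l\<close>. Conversely, Popoviciu's inequality
  is nearly attained by a measure that puts almost all of its mass, in equal parts, on two points
  where \<open>f\<close> is nearly extremal. As the second eigenvalue is the minimum of the Rayleigh quotient over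
  mean-zero functions, a lower bound \<open>l\<close> for all second eigenvalues yields the Poincare inequality
  with constant \<open>4 / l\<close>.
\<close>

subsection \<open>Weighted square-summable functions\<close>

lemma ell2_mult_summable:
  assumes "\<And>x. 0 \<le> m x" "f \<in> ell2 m" "g \<in> ell2 m"
  shows "(\<lambda>x. f x * g x * m x) summable_on UNIV"
proof -
  have "(\<lambda>x. norm (f x * g x * m x)) summable_on UNIV"
  proof (rule summable_on_comparison_test)
    show "(\<lambda>x. (f x)\<^sup>2 * m x + (g x)\<^sup>2 * m x) summable_on UNIV"
      using assms by (auto simp: ell2_def intro: summable_on_add)
    fix x
    have "\<bar>f x * g x\<bar> \<le> 2 * \<bar>f x\<bar> * \<bar>g x\<bar>"
      by (simp add: abs_mult)
    also have "\<dots> \<le> (f x)\<^sup>2 + (g x)\<^sup>2"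
      using sum_squares_bound[of "\<bar>f x\<bar>" "\<bar>g x\<bar>"] by simp
    finally have "\<bar>f x * g x\<bar> * m x \<le> ((f x)\<^sup>2 + (g x)\<^sup>2) * m x"
      using assms(1) by (rule mult_right_mono)
    then show "norm (f x * g x * m x) \<le> (f x)\<^sup>2 * m x + (g x)\<^sup>2 * m x"
      using assms(1)[of x] by (simp add: abs_mult distrib_right)
  qed auto
  then show ?thesis
    by (rule abs_summable_summable)
qed

text \<open>This and the next lemmas use the one shape \<open>s * f x + t * g x\<close>, so that
  sums, differences, scalings and centring are all instances. This is why later proofs write out
  coefficients such as \<open>1\<close>, \<open>- 1\<close> and \<open>0\<close>. The weight is only
  assumed nonnegative, since it also serves for edge weights.\<close>

lemma ell2_lincomb:
  assumes "\<And>x. 0 \<le> m x" "f \<in> ell2 m" "g \<in> ell2 m"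
  shows "(\<lambda>x. s * f x + t * g x) \<in> ell2 m"
proof -
  have "(\<lambda>x. s\<^sup>2 * ((f x)\<^sup>2 * m x) + (2 * s * t) * (f x * g x * m x) + t\<^sup>2 * ((g x)\<^sup>2 * m x))
    summable_on UNIV"
    using assms ell2_mult_summable[OF assms]
    by (intro summable_on_add summable_on_cmult_right) (auto simp: ell2_def)
  then show ?thesis
    unfolding ell2_def by (simp add: power2_eq_square algebra_simps)
qed

lemma ell2_inner_lincomb_left:
  assumes "\<And>x. 0 \<le> m x" "f \<in> ell2 m" "g \<in> ell2 m" "h \<in> ell2 m"
  shows "ell2_inner m (\<lambda>x. s * f x + t * g x) h = s * ell2_inner m f h + t * ell2_inner m g h"
proof -
  have "ell2_inner m (\<lambda>x. s * f x + t * g x) h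
      = (\<Sum>\<^sub>\<infinity>x. s * (f x * h x * m x) + t * (g x * h x * m x))"
    by (simp add: ell2_inner_def algebra_simps)
  also have "\<dots> = s * ell2_inner m f h + t * ell2_inner m g h"
    unfolding ell2_inner_def
    by (subst infsum_add)
       (use ell2_mult_summable[OF assms(1)] assms in
        \<open>auto intro!: summable_on_cmult_right simp: infsum_cmult_right'\<close>)
  finally show ?thesis .
qed

lemma ell2_inner_commute: "ell2_inner m f g = ell2_inner m g f"
  by (simp add: ell2_inner_def mult.commute)

lemma ell2_inner_lincomb_right:
  assumes "\<And>x. 0 \<le> m x" "f \<in> ell2 m" "g \<in> ell2 m" "h \<in> ell2 m"
  shows "ell2_inner m h (\<lambda>x. s * f x + t * g x) = s * ell2_inner m h f + t * ell2_inner m h g"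
  using ell2_inner_lincomb_left[OF assms] by (simp add: ell2_inner_commute[of m h])

lemma ell2_inner_self_lincomb:
  assumes "\<And>x. 0 \<le> m x" "f \<in> ell2 m" "g \<in> ell2 m"
  shows "ell2_inner m (\<lambda>x. s * f x + t * g x) (\<lambda>x. s * f x + t * g x)
    = s\<^sup>2 * ell2_inner m f f + 2 * s * t * ell2_inner m f g + t\<^sup>2 * ell2_inner m g g"
  using assms
  by (simp add: ell2_inner_lincomb_left ell2_inner_lincomb_right ell2_lincomb
      ell2_inner_commute[of m g f] power2_eq_square algebra_simps)

lemma ell2_inner_self_nonneg: "(\<And>x. 0 \<le> m x) \<Longrightarrow> 0 \<le> ell2_inner m f f"
  by (auto simp: ell2_inner_def intro!: infsum_nonneg)

lemma ell2_inner_self_ge: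
  assumes "\<And>x. 0 \<le> m x" "f \<in> ell2 m" "finite F"
  shows "(\<Sum>x\<in>F. (f x)\<^sup>2 * m x) \<le> ell2_inner m f f"
  using assms finite_sum_le_infsum[of "\<lambda>x. (f x)\<^sup>2 * m x" UNIV F]
  by (auto simp: ell2_def ell2_inner_def power2_eq_square)

lemma ell2_inner_self_le_0D:
  assumes "\<And>x. 0 < m x" "f \<in> ell2 m" "ell2_inner m f f \<le> 0"
  shows "f = (\<lambda>_. 0)"
proof
  fix x
  have "(f x)\<^sup>2 * m x \<le> 0"
    using ell2_inner_self_ge[of m f "{x}"] assms by (simp add: less_imp_le)
  then show "f x = 0"
    using assms(1)[of x] by (simp add: mult_le_0_iff not_le)
qed

text \<open>Fatou's lemma for sums: every finite partial sum converges and stays below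
  \<open>L\<close>, and finite partial sums determine both summability and the sum of nonnegative
  terms. Applied to edge weights it yields lower semicontinuity of the energy.\<close>

lemma ell2_fatou:
  fixes m :: "'i::countable \<Rightarrow> real"
  assumes "\<And>x. 0 \<le> m x" "\<And>n. F n \<in> ell2 m" "\<And>x. (\<lambda>n. F n x) \<longlonglongrightarrow> f x"
    and "(\<lambda>n. ell2_inner m (F n) (F n)) \<longlonglongrightarrow> L"
  shows "f \<in> ell2 m" "ell2_inner m f f \<le> L"
proof -
  have *: "(\<Sum>x\<in>A. (f x)\<^sup>2 * m x) \<le> L" if "finite A" for A
  proof (rule LIMSEQ_le)
    show "(\<lambda>n. \<Sum>x\<in>A. (F n x)\<^sup>2 * m x) \<longlonglongrightarrow> (\<Sum>x\<in>A. (f x)\<^sup>2 * m x)"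
      by (intro tendsto_intros assms)
    show "\<exists>N. \<forall>n\<ge>N. (\<Sum>x\<in>A. (F n x)\<^sup>2 * m x) \<le> ell2_inner m (F n) (F n)"
      using ell2_inner_self_ge[OF assms(1,2) that] by blast
  qed (rule assms)
  show 1: "f \<in> ell2 m"
    unfolding ell2_def mem_Collect_eq
    by (rule nonneg_bdd_above_summable_on)
       (use assms(1) * in \<open>auto intro!: bdd_aboveI[of _ L]\<close>)
  have "(\<Sum>\<^sub>\<infinity>x. (f x)\<^sup>2 * m x) \<le> L"
    by (rule infsum_le_finite_sums) (use 1 * in \<open>auto simp: ell2_def\<close>)
  then show "ell2_inner m f f \<le> L"
    by (simp add: ell2_inner_def power2_eq_square)
qed

section \<open>Sums against probability weights as expectations; convergence and compactness\<close>

text \<open>The measure of a \<open>pmf\<close> has density \<open>pmf p\<close> with respect to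
  counting measure. The identity makes monotonicity and dominated convergence of integrals available
  for \<open>ell2_inner\<close>.\<close>

lemma expectation_eq_infsum:
  fixes f :: "'i::countable \<Rightarrow> real"
  assumes "integrable (measure_pmf p) f"
  shows "measure_pmf.expectation p f = (\<Sum>\<^sub>\<infinity>x. f x * pmf p x)"
    and "(\<lambda>x. f x * pmf p x) summable_on UNIV"
proof -
  have 1: "Infinite_Set_Sum.abs_summable_on (\<lambda>x. pmf p x * f x) UNIV"
    using assms unfolding measure_pmf_eq_density
    by (subst (asm) integrable_density) (auto simp: abs_summable_on_def)
  have "measure_pmf.expectation p f = (\<integral>x. pmf p x * f x \<partial>count_space UNIV)"
    unfolding measure_pmf_eq_density by (subst integral_density) auto
  also have "\<dots> = infsetsum (\<lambda>x. pmf p x * f x) UNIV"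
    by (simp add: infsetsum_def)
  also have "\<dots> = infsum (\<lambda>x. pmf p x * f x) UNIV"
    by (rule infsetsum_infsum[OF 1])
  finally show "measure_pmf.expectation p f = (\<Sum>\<^sub>\<infinity>x. f x * pmf p x)"
    by (simp add: mult.commute)
  show "(\<lambda>x. f x * pmf p x) summable_on UNIV"
    using abs_summable_summable[OF abs_summable_equivalent[THEN iffD2, OF 1]]
    by (simp add: mult.commute)
qed

lemma ell2_inner_pmf:
  fixes f g :: "'i::countable \<Rightarrow> real"
  assumes "\<And>x. \<bar>f x\<bar> \<le> B" "\<And>x. \<bar>g x\<bar> \<le> B"
  shows "ell2_inner (pmf p) f g = measure_pmf.expectation p (\<lambda>x. f x * g x)"
  unfolding ell2_inner_def
proof (rule expectation_eq_infsum(1)[symmetric])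
  have "\<bar>f x * g x\<bar> \<le> B * B" for x
    using assms(1)[of x] assms(2)[of x] by (auto simp: abs_mult intro!: mult_mono)
  then show "integrable (measure_pmf p) (\<lambda>x. f x * g x)"
    by (intro measure_pmf.integrable_const_bound[where B="B * B"]) auto
qed

lemma bounded_in_ell2_pmf:
  fixes f :: "'i::countable \<Rightarrow> real"
  assumes "\<And>x. \<bar>f x\<bar> \<le> B"
  shows "f \<in> ell2 (pmf p)"
proof -
  have "(f x)\<^sup>2 \<le> B\<^sup>2" for x
    using power_mono[OF assms[of x], of 2] by simp
  then have "integrable (measure_pmf p) (\<lambda>x. (f x)\<^sup>2)"
    by (intro measure_pmf.integrable_const_bound[where B="B\<^sup>2"]) auto
  then show ?thesis
    unfolding ell2_def mem_Collect_eq by (rule expectation_eq_infsum(2))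
qed

text \<open>Dominated convergence; the constant \<open>B * B\<close> is an integrable majorant
  because the total mass is \<open>1\<close>.\<close>

lemma ell2_inner_pmf_tendsto:
  fixes f g :: "'i::countable \<Rightarrow> real"
  assumes "\<And>n x. \<bar>F n x\<bar> \<le> B" "\<And>n x. \<bar>G n x\<bar> \<le> B"
    and "\<And>x. (\<lambda>n. F n x) \<longlonglongrightarrow> f x" "\<And>x. (\<lambda>n. G n x) \<longlonglongrightarrow> g x"
  shows "(\<lambda>n. ell2_inner (pmf p) (F n) (G n)) \<longlonglongrightarrow> ell2_inner (pmf p) f g"
proof -
  have fB: "\<bar>f x\<bar> \<le> B" for x
    by (rule LIMSEQ_le_const2[OF tendsto_rabs[OF assms(3)]]) (use assms in auto)
  have gB: "\<bar>g x\<bar> \<le> B" for x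
    by (rule LIMSEQ_le_const2[OF tendsto_rabs[OF assms(4)]]) (use assms in auto)
  have "\<bar>F n x * G n x\<bar> \<le> B * B" for n x
    using assms(1)[of n x] assms(2)[of n x] by (auto simp: abs_mult intro!: mult_mono)
  then have "(\<lambda>n. measure_pmf.expectation p (\<lambda>x. F n x * G n x))
      \<longlonglongrightarrow> measure_pmf.expectation p (\<lambda>x. f x * g x)"
    by (intro integral_dominated_convergence[where w="\<lambda>_. B * B"])
       (use assms in \<open>auto intro!: tendsto_mult\<close>)
  then show ?thesis
    using assms fB gB by (simp add: ell2_inner_pmf[where B=B])
qed

text \<open>By Tychonoff the cube with sides \<open>{-B..B}\<close> is compact in the product
  topology. Countability of the index type makes this topology first countable, so compactness gives
  convergent subsequences without a diagonal argument.\<close>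

lemma bounded_seq_pointwise_subseq:
  fixes F :: "nat \<Rightarrow> 'i::countable \<Rightarrow> real"
  assumes "\<And>n x. \<bar>F n x\<bar> \<le> B"
  obtains f r where "strict_mono r" "\<And>x. (\<lambda>n. F (r n) x) \<longlonglongrightarrow> f x"
proof -
  have "compact (\<Pi>\<^sub>E i\<in>(UNIV::'i set). {-B..B})"
    using compactin_PiE[of "\<lambda>_. euclideanreal" "UNIV::'i set" "\<lambda>_. {-B..B}"]
    by (simp add: euclidean_product_topology)
  then have "seq_compact (\<Pi>\<^sub>E i\<in>(UNIV::'i set). {-B..B})"
    by (rule compact_imp_seq_compact)
  moreover have "F n \<in> (\<Pi>\<^sub>E i\<in>(UNIV::'i set). {-B..B})" for n
    using assms[of n] by (auto simp: abs_le_iff minus_le_iff)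
  ultimately obtain f r where fr: "strict_mono r" "(F \<circ> r) \<longlonglongrightarrow> f"
    unfolding seq_compact_def by metis
  have "(\<lambda>n. F (r n) x) \<longlonglongrightarrow> f x" for x
    using fr(2) limitin_componentwise[of "\<lambda>_. euclideanreal" "UNIV::'i set" "F \<circ> r" f sequentially]
    by (simp add: euclidean_product_topology o_def)
  then show ?thesis using fr(1) that by blast
qed

subsection \<open>Variation and variance\<close>

text \<open>Trades the extended-real supremum and infimum for differences over pairs of points, the
  form in which the Poincare inequality is used throughout.\<close>

lemma variation_sq_le_iff:
  "(variation f)\<^sup>2 \<le> ereal K \<longleftrightarrow> (\<forall>x y. (f x - f y)\<^sup>2 \<le> K)"
proof -
  have le: "ereal (f x - f y) \<le> variation f" for x y
    unfolding variation_def
    using ereal_minus_mono[OF SUP_upper[of x UNIV "\<lambda>x. ereal (f x)"] INF_lower[of y UNIV "\<lambda>x. ereal (f x)"]]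
    by simp
  show ?thesis
  proof
  assume K: "(variation f)\<^sup>2 \<le> ereal K"
  \<comment> \<open>The squared bound excludes plus infinity, and \<open>le\<close> at two equal
    points excludes minus infinity; \<open>undefined\<close> merely names some vertex.\<close>
  from K le obtain v where v: "variation f = ereal v"
    by (cases "variation f") (use le[of undefined undefined] in auto)
  show "\<forall>x y. (f x - f y)\<^sup>2 \<le> K"
  proof (intro allI)
    fix x y
    have "\<bar>f x - f y\<bar> \<le> v"
      using le[of x y] le[of y x] v by auto
    then have "(f x - f y)\<^sup>2 \<le> v\<^sup>2"
      by (metis abs_ge_zero power2_abs power_mono)
    with K v show "(f x - f y)\<^sup>2 \<le> K" by simp
  qed
next
  assume K: "\<forall>x y. (f x - f y)\<^sup>2 \<le> K"
  have K0: "0 \<le> K" using K[rule_format, of undefined undefined] by simp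
  have d: "f x - sqrt K \<le> f y" for x y
    using real_le_rsqrt[OF K[rule_format, of x y]] by simp
  have bd: "bdd_below (range f)"
    by (rule bdd_belowI[of _ "f undefined - sqrt K"]) (use d in auto)
  define I where "I = (INF x. f x)"
  have S: "(SUP x. ereal (f x)) \<le> ereal (I + sqrt K)"
  proof (rule SUP_least)
    fix x
    have "f x - sqrt K \<le> I" unfolding I_def by (rule cINF_greatest) (use d in auto)
    then show "ereal (f x) \<le> ereal (I + sqrt K)" by simp
  qed
  have I: "ereal I \<le> (INF x. ereal (f x))"
    unfolding I_def by (rule INF_greatest) (use bd in \<open>auto intro: cINF_lower\<close>)
  have "variation f \<le> ereal (sqrt K)"
    using ereal_minus_mono[OF S I] by (simp add: variation_def)
  then show "(variation f)\<^sup>2 \<le> ereal K"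
    using le[of undefined undefined] K0
    by (cases "variation f") (auto dest: power_mono[of _ "sqrt K" 2])
qed
qed

text \<open>The geometric distribution charges every natural number, and \<open>from_nat\<close> is
  surjective.\<close>

lemma exists_full_support_pmf: "\<exists>p :: 'i::countable pmf. set_pmf p = UNIV"
proof
  show "set_pmf (map_pmf (from_nat :: nat \<Rightarrow> 'i) (geometric_pmf (1 / 2))) = UNIV"
    by (simp add: set_pmf_geometric)
qed

text \<open>A mixture: with probability \<open>e\<close> draw from a law of full support, otherwise
  uniformly from the two points.\<close>

lemma exists_full_support_pmf_near_two_points:
  fixes x y :: "'i::countable"
  assumes "0 < e" "e < 1" "x \<noteq> y"
  obtains p where "set_pmf p = UNIV" "(1 - e) / 2 \<le> pmf p x" "(1 - e) / 2 \<le> pmf p y"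
proof -
  obtain q :: "'i pmf" where q: "set_pmf q = UNIV"
    using exists_full_support_pmf by blast
  define p where "p = bind_pmf (bernoulli_pmf e) (\<lambda>b. if b then q else pmf_of_set {x, y})"
  have p: "pmf p z = e * pmf q z + (1 - e) * pmf (pmf_of_set {x, y}) z" for z
    unfolding p_def pmf_bind using assms by simp
  show thesis
  proof (rule that)
    have "0 < pmf p z" for z
      unfolding p using assms q by (intro add_pos_nonneg mult_pos_pos) (auto simp: pmf_positive)
    then show "set_pmf p = UNIV"
      by (auto simp: set_pmf_iff less_le)
  qed (use assms in \<open>auto simp: p pmf_of_set\<close>)
qed

text \<open>Popoviciu's inequality. The values lie in an interval of length \<open>sqrt K\<close>
  from \<open>I\<close>, so \<open>(f - I) * (I + sqrt K - f)\<close> is nonnegative; taking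
  expectations with mean zero bounds the variance by \<open>- I * (I + sqrt K)\<close>. Mean zero
  also places \<open>0\<close> in that interval, which gives the pointwise bound.\<close>

lemma mean_zero_variance_le:
  fixes f :: "'i::countable \<Rightarrow> real"
  assumes "ell2_inner (pmf p) f (\<lambda>_. 1) = 0" and K: "\<And>x y. (f x - f y)\<^sup>2 \<le> K"
  shows "\<bar>f x\<bar> \<le> sqrt K" and "ell2_inner (pmf p) f f \<le> K / 4"
proof -
  have K0: "0 \<le> K" using K[of undefined undefined] by simp
  have d: "f x - sqrt K \<le> f y" for x y
    using real_le_rsqrt[OF K[of x y]] by simp
  define I where "I = (INF x. f x)"
  have bd: "bdd_below (range f)"
    by (rule bdd_belowI[of _ "f undefined - sqrt K"]) (use d in auto)
  have I1: "I \<le> f x" for x unfolding I_def by (rule cINF_lower[OF bd]) auto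
  have I2: "f x \<le> I + sqrt K" for x
  proof -
    have "f x - sqrt K \<le> I" unfolding I_def by (rule cINF_greatest) (use d in auto)
    then show ?thesis by simp
  qed
  \<comment> \<open>The maximum with \<open>1\<close> lets the same bound cover the constant
    function \<open>1\<close> in the product that expresses the mean.\<close>
  define B where "B = max 1 (\<bar>I\<bar> + sqrt K)"
  have fB: "\<bar>f x\<bar> \<le> B" for x
    using I1[of x] I2[of x] K0 unfolding B_def by (auto simp: abs_le_iff max_def)
  have B1: "\<bar>1\<bar> \<le> B" by (simp add: B_def)
  have int: "integrable (measure_pmf p) f"
    by (intro measure_pmf.integrable_const_bound[where B=B]) (auto simp: fB)
  have "\<bar>f x * f x\<bar> \<le> B * B" for x
    using mult_mono[OF fB[of x] fB[of x]] B1 by simp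
  then have int2: "integrable (measure_pmf p) (\<lambda>x. f x * f x)"
    by (intro measure_pmf.integrable_const_bound[where B="B * B"]) auto
  have E0: "measure_pmf.expectation p f = 0"
    using assms(1) ell2_inner_pmf[of f B "\<lambda>_. 1" p] fB B1 by simp
  have "I \<le> measure_pmf.expectation p f"
    using I1 int by (intro measure_pmf.integral_ge_const) auto
  then have I_le: "I \<le> 0" using E0 by simp
  have "measure_pmf.expectation p f \<le> I + sqrt K"
    using I2 int by (intro measure_pmf.integral_le_const) auto
  then have I_ge: "0 \<le> I + sqrt K" using E0 by simp
  show "\<bar>f x\<bar> \<le> sqrt K"
    using I1[of x] I2[of x] I_le I_ge by (auto simp: abs_le_iff)
  have *: "f x * f x \<le> (2 * I + sqrt K) * f x + (- I * (I + sqrt K))" for x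
    using mult_nonneg_nonneg[of "f x - I" "I + sqrt K - f x"] I1[of x] I2[of x]
    by (simp add: algebra_simps)
  have "ell2_inner (pmf p) f f = measure_pmf.expectation p (\<lambda>x. f x * f x)"
    using fB fB by (rule ell2_inner_pmf)
  also have "\<dots> \<le> measure_pmf.expectation p (\<lambda>x. (2 * I + sqrt K) * f x + (- I * (I + sqrt K)))"
    using int int2 * by (intro integral_mono) auto
  also have "\<dots> = - I * (I + sqrt K)"
    using int E0 by (subst Bochner_Integration.integral_add) auto
  \<comment> \<open>The right side minus the left side is
    \<open>(I + sqrt K / 2)\<^sup>2\<close>.\<close>
  also have "\<dots> \<le> (sqrt K)\<^sup>2 / 4"
    using zero_le_power2[of "I + sqrt K / 2"] by (simp add: power2_eq_square algebra_simps)
  finally show "ell2_inner (pmf p) f f \<le> K / 4" using K0 by simp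
qed

subsection \<open>The energy form under a Poincare inequality\<close>

text \<open>The discrete gradient on ordered pairs. It turns the energy into half an
  \<open>ell2_inner\<close> with weight \<open>case_prod b\<close>, so the lemmas on weighted
  square-summable functions apply to the energy as well.\<close>

definition coboundary :: "('a \<Rightarrow> real) \<Rightarrow> 'a \<times> 'a \<Rightarrow> real" where
  "coboundary f = (\<lambda>(x, y). f x - f y)"

lemma coboundary_lincomb:
  "coboundary (\<lambda>x. s * f x + t * g x) = (\<lambda>e. s * coboundary f e + t * coboundary g e)"
  by (auto simp: coboundary_def fun_eq_iff algebra_simps)

lemma coboundary_const: "coboundary (\<lambda>_. k) = (\<lambda>_. 0)"
  by (auto simp: coboundary_def)

lemma finite_energy_iff: "f \<in> finite_energy b \<longleftrightarrow> coboundary f \<in> ell2 (case_prod b)"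
  by (simp add: finite_energy_def ell2_def coboundary_def case_prod_beta' mult.commute)

lemma energy_eq: "energy b f g = ell2_inner (case_prod b) (coboundary f) (coboundary g) / 2"
  by (simp add: energy_def ell2_inner_def coboundary_def case_prod_beta' mult_ac)

lemma global_poincare_iff:
  "global_poincare b c \<longleftrightarrow> (\<forall>f\<in>finite_energy b. \<forall>x y. (f x - f y)\<^sup>2 \<le> c * energy b f f)"
  unfolding global_poincare_def variation_sq_le_iff ..

text \<open>First-order condition at a minimum, used for the variation of the Rayleigh
  quotient.\<close>

lemma linear_coefficient_eq_0:
  fixes A B :: real
  assumes "\<And>t. 0 \<le> 2 * t * A + t\<^sup>2 * B"
  shows "A = 0"
proof (rule ccontr)
  assume A: "A \<noteq> 0"
  \<comment> \<open>The step \<open>t = - A / (\<bar>B\<bar> + 1)\<close> goes against the slope and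
    is short enough for the linear term to win; the \<open>+ 1\<close> keeps the denominator
    positive when \<open>B = 0\<close>.\<close>
  have "0 \<le> 2 * (- A / (\<bar>B\<bar> + 1)) * A + (- A / (\<bar>B\<bar> + 1))\<^sup>2 * B" by (rule assms)
  also have "\<dots> = A\<^sup>2 * (B - 2 * (\<bar>B\<bar> + 1)) / (\<bar>B\<bar> + 1)\<^sup>2"
    by (simp add: power2_eq_square divide_simps) (simp add: algebra_simps)
  also have "\<dots> < 0"
    using A by (intro divide_neg_pos mult_pos_neg) (auto simp: add_pos_nonneg)
  finally show False by simp
qed

locale poincare_graph =
  fixes b :: "'a::countable \<Rightarrow> 'a \<Rightarrow> real" and c :: real
  assumes weights_nonneg: "0 \<le> b x y"
    and poincare: "global_poincare b c"
begin

lemma prod_weights_nonneg: "0 \<le> case_prod b e"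
  by (simp add: case_prod_beta weights_nonneg)

lemma poincare_ineq: "f \<in> finite_energy b \<Longrightarrow> (f x - f y)\<^sup>2 \<le> c * energy b f f"
  using poincare unfolding global_poincare_iff by blast

lemma energy_nonneg: "0 \<le> energy b f f"
  by (simp add: energy_eq ell2_inner_self_nonneg prod_weights_nonneg)

lemma finite_energy_lincomb:
  "f \<in> finite_energy b \<Longrightarrow> g \<in> finite_energy b \<Longrightarrow> (\<lambda>x. s * f x + t * g x) \<in> finite_energy b"
  by (simp add: finite_energy_iff coboundary_lincomb ell2_lincomb prod_weights_nonneg)

lemma energy_self_lincomb:
  assumes "f \<in> finite_energy b" "g \<in> finite_energy b"
  shows "energy b (\<lambda>x. s * f x + t * g x) (\<lambda>x. s * f x + t * g x)
    = s\<^sup>2 * energy b f f + 2 * s * t * energy b f g + t\<^sup>2 * energy b g g"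
  using assms
  by (simp add: finite_energy_iff energy_eq coboundary_lincomb ell2_inner_self_lincomb
      prod_weights_nonneg add_divide_distrib)

lemma const_finite_energy: "(\<lambda>_. k) \<in> finite_energy b"
  by (simp add: finite_energy_iff coboundary_const ell2_def)

lemma energy_const: "energy b (\<lambda>_. k) f = 0" "energy b f (\<lambda>_. k) = 0"
  by (simp_all add: energy_eq coboundary_const ell2_inner_def)

lemma energy_eq_0D:
  assumes "f \<in> finite_energy b" "energy b f f = 0"
  shows "f x = f y"
  using poincare_ineq[OF assms(1), of x y] assms(2) by simp

lemma finite_energy_bounded:
  assumes "f \<in> finite_energy b"
  obtains B where "\<And>x. \<bar>f x\<bar> \<le> B"
proof
  fix x
  have "\<bar>f x - f undefined\<bar> \<le> sqrt (c * energy b f f)"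
    using poincare_ineq[OF assms] by (intro real_le_rsqrt) simp
  then show "\<bar>f x\<bar> \<le> \<bar>f undefined\<bar> + sqrt (c * energy b f f)" by linarith
qed

lemma energy_fatou:
  assumes "\<And>n. F n \<in> finite_energy b" "\<And>x. (\<lambda>n. F n x) \<longlonglongrightarrow> f x"
    and "(\<lambda>n. energy b (F n) (F n)) \<longlonglongrightarrow> L"
  shows "f \<in> finite_energy b" "energy b f f \<le> L"
proof -
  have 1: "(\<lambda>n. coboundary (F n) e) \<longlonglongrightarrow> coboundary f e" for e
    by (auto simp: coboundary_def case_prod_beta intro!: tendsto_diff assms)
  have 2: "(\<lambda>n. ell2_inner (case_prod b) (coboundary (F n)) (coboundary (F n))) \<longlonglongrightarrow> 2 * L"
    using tendsto_mult_left[OF assms(3), of 2] by (simp add: energy_eq)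
  note fatou = ell2_fatou[OF prod_weights_nonneg assms(1)[unfolded finite_energy_iff] 1 2]
  show "f \<in> finite_energy b" "energy b f f \<le> L"
    using fatou by (simp_all add: finite_energy_iff energy_eq)
qed

end

subsection \<open>The spectrum of the Neumann Laplacian\<close>

locale poincare_graph_measure = poincare_graph b c
  for b :: "'a::countable \<Rightarrow> 'a \<Rightarrow> real" and c :: real +
  fixes m :: "'a pmf"
  assumes full_support: "set_pmf m = UNIV"
begin

abbreviation inner (infix "\<bullet>\<^sub>m" 70) where "f \<bullet>\<^sub>m g \<equiv> ell2_inner (pmf m) f g"

lemma finite_energy_subset_ell2: "f \<in> finite_energy b \<Longrightarrow> f \<in> ell2 (pmf m)"
  using finite_energy_bounded bounded_in_ell2_pmf by metis

text \<open>The Poincare inequality bounds every function of finite energy, and bounded functions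
  are square-summable for a probability measure. The form domain is thus the same for all
  \<open>m\<close>.\<close>

lemma neumann_form_domain_eq: "neumann_form_domain b (pmf m) = finite_energy b"
  using finite_energy_subset_ell2 by (auto simp: neumann_form_domain_def)

lemma inner_one_one: "(\<lambda>_. 1) \<bullet>\<^sub>m (\<lambda>_. 1) = 1"
  by (subst ell2_inner_pmf[where B=1]) auto

lemma inner_const_left: "(\<lambda>_. k) \<bullet>\<^sub>m f = k * ((\<lambda>_. 1) \<bullet>\<^sub>m f)"
  by (simp add: ell2_inner_def infsum_cmult_right' mult.assoc)

lemma inner_self_pos:
  assumes "f \<in> ell2 (pmf m)" "f \<noteq> (\<lambda>_. 0)"
  shows "0 < f \<bullet>\<^sub>m f"
  using ell2_inner_self_le_0D[of "pmf m" f] assms full_support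
  by (force simp: pmf_positive not_le)

text \<open>Density of the form domain: the difference \<open>d\<close> is orthogonal to it, yet
  lies close to a difference \<open>k\<close> of two of its elements, so its norm is arbitrarily
  small. This makes the image under the operator unique.\<close>

lemma neumann_space_orthogonal_eq_0:
  assumes g: "g \<in> neumann_space b (pmf m)" "g' \<in> neumann_space b (pmf m)"
    and orth: "\<And>h. h \<in> finite_energy b \<Longrightarrow> g \<bullet>\<^sub>m h = g' \<bullet>\<^sub>m h"
  shows "g = g'"
proof -
  define d where "d = (\<lambda>x. 1 * g x + (- 1) * g' x)"
  have gl: "g \<in> ell2 (pmf m)" "g' \<in> ell2 (pmf m)"
    using g by (auto simp: neumann_space_def)
  have dl: "d \<in> ell2 (pmf m)"
    unfolding d_def by (intro ell2_lincomb gl) simp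
  have dh: "d \<bullet>\<^sub>m h = 0" if "h \<in> finite_energy b" for h
    unfolding d_def
    by (subst ell2_inner_lincomb_left) (use gl that orth finite_energy_subset_ell2 in auto)
  have small: "d \<bullet>\<^sub>m d \<le> 4 * e\<^sup>2" if "0 < e" for e
  proof -
    obtain h where h: "h \<in> finite_energy b" "ell2_norm (pmf m) (\<lambda>x. g x - h x) < e"
      using g(1) \<open>0 < e\<close> unfolding neumann_space_def neumann_form_domain_eq by blast
    obtain h' where h': "h' \<in> finite_energy b" "ell2_norm (pmf m) (\<lambda>x. g' x - h' x) < e"
      using g(2) \<open>0 < e\<close> unfolding neumann_space_def neumann_form_domain_eq by blast
    define u where "u = (\<lambda>x. 1 * g x + (- 1) * h x)"
    define u' where "u' = (\<lambda>x. 1 * g' x + (- 1) * h' x)"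
    define k where "k = (\<lambda>x. 1 * h x + (- 1) * h' x)"
    have hl: "h \<in> ell2 (pmf m)" "h' \<in> ell2 (pmf m)"
      using h h' finite_energy_subset_ell2 by auto
    have ul: "u \<in> ell2 (pmf m)" "u' \<in> ell2 (pmf m)"
      unfolding u_def u'_def by (intro ell2_lincomb gl hl; simp)+
    have k: "k \<in> finite_energy b"
      unfolding k_def using h h' by (intro finite_energy_lincomb) auto
    have u: "u \<bullet>\<^sub>m u \<le> e\<^sup>2" "u' \<bullet>\<^sub>m u' \<le> e\<^sup>2"
      using h(2) h'(2) sqrt_le_D[of "u \<bullet>\<^sub>m u" e] sqrt_le_D[of "u' \<bullet>\<^sub>m u'" e]
      by (simp_all add: ell2_norm_def u_def u'_def)
    \<comment> \<open>Pythagoras: \<open>d\<close> is orthogonal to \<open>k\<close>, so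
      \<open>d\<close> is no longer than \<open>d - k = u - u'\<close>.\<close>
    have "d \<bullet>\<^sub>m d \<le> d \<bullet>\<^sub>m d + k \<bullet>\<^sub>m k"
      by (simp add: ell2_inner_self_nonneg)
    also have "\<dots> = (\<lambda>x. 1 * d x + (- 1) * k x) \<bullet>\<^sub>m (\<lambda>x. 1 * d x + (- 1) * k x)"
      by (subst ell2_inner_self_lincomb) (use dl k finite_energy_subset_ell2 dh in auto)
    also have "\<dots> = (\<lambda>x. 1 * u x + (- 1) * u' x) \<bullet>\<^sub>m (\<lambda>x. 1 * u x + (- 1) * u' x)"
      by (simp add: d_def k_def u_def u'_def algebra_simps)
    \<comment> \<open>Adding the square of \<open>u + u'\<close> cancels the mixed term, as in the
      parallelogram law.\<close>
    also have "\<dots> \<le> (\<lambda>x. 1 * u x + (- 1) * u' x) \<bullet>\<^sub>m (\<lambda>x. 1 * u x + (- 1) * u' x)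
        + (\<lambda>x. 1 * u x + 1 * u' x) \<bullet>\<^sub>m (\<lambda>x. 1 * u x + 1 * u' x)"
      by (simp add: ell2_inner_self_nonneg)
    also have "\<dots> = 2 * (u \<bullet>\<^sub>m u) + 2 * (u' \<bullet>\<^sub>m u')"
      using ul by (subst (1 2) ell2_inner_self_lincomb) auto
    also have "\<dots> \<le> 4 * e\<^sup>2" using u by simp
    finally show ?thesis .
  qed
  have "d \<bullet>\<^sub>m d \<le> e" if "0 < e" for e
    using small[of "sqrt e / 2"] that by (simp add: power_divide)
  then have "d \<bullet>\<^sub>m d \<le> 0"
    by (rule dense_ge)
  then have "d = (\<lambda>_. 0)"
    using inner_self_pos[OF dl] by force
  then show ?thesis by (simp add: d_def fun_eq_iff)
qed

text \<open>The weak eigenvalue equation. Uniqueness of the representing function resolves the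
  definite description, and \<open>l * f\<close> lies in the Hilbert space because \<open>f\<close>
  has finite energy.\<close>

lemma neumann_eigenvalues_eq:
  "neumann_eigenvalues b (pmf m) =
    {l. \<exists>f\<in>finite_energy b. f \<noteq> (\<lambda>_. 0) \<and> (\<forall>h\<in>finite_energy b. energy b f h = l * (f \<bullet>\<^sub>m h))}"
proof -
  have unique: "g = g'"
    if "represents_form b (pmf m) f g" "represents_form b (pmf m) f g'" for f g g'
    using that neumann_space_orthogonal_eq_0[of g g']
    by (simp add: represents_form_def neumann_form_domain_eq)
  have scale: "(\<lambda>x. l * f x) \<bullet>\<^sub>m h = l * (f \<bullet>\<^sub>m h)" for l f h
    by (simp add: ell2_inner_def infsum_cmult_right' mult.assoc)
  have space: "f \<in> neumann_space b (pmf m)" if "f \<in> finite_energy b" for f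
    unfolding neumann_space_def neumann_form_domain_eq
    using that finite_energy_subset_ell2
    by (auto intro!: bexI[of _ f] simp: ell2_norm_def ell2_inner_def)
  have "f \<in> neumann_domain b (pmf m) \<and> neumann_laplacian b (pmf m) f = (\<lambda>x. l * f x) \<longleftrightarrow>
      f \<in> finite_energy b \<and> represents_form b (pmf m) f (\<lambda>x. l * f x)" for f l
    unfolding neumann_domain_def neumann_laplacian_def neumann_form_domain_eq
    using unique by (auto intro!: the_equality) (metis the_equality)
  moreover have "represents_form b (pmf m) f (\<lambda>x. l * f x) \<longleftrightarrow>
      (\<forall>h\<in>finite_energy b. energy b f h = l * (f \<bullet>\<^sub>m h))" if "f \<in> finite_energy b" for f l
    using space finite_energy_lincomb[OF that that, of l 0]
    by (simp add: represents_form_def neumann_form_domain_eq scale that)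
  ultimately show ?thesis
    unfolding neumann_eigenvalues_def by (intro Collect_cong) blast
qed

section \<open>Zero and nonzero eigenvalues\<close>

lemma zero_eigenvalue: "0 \<in> neumann_eigenvalues b (pmf m)"
  unfolding neumann_eigenvalues_eq
  by (auto intro!: bexI[of _ "\<lambda>_. 1"] simp: energy_const const_finite_energy fun_eq_iff)

text \<open>Testing the weak equation against \<open>1\<close> gives \<open>0\<close> for the
  energy, hence mean zero as \<open>l\<close> is nonzero; testing against \<open>f\<close> gives the
  last equation.\<close>

lemma nonzero_eigenvalueE:
  assumes "l \<in> neumann_eigenvalues b (pmf m)" "l \<noteq> 0"
  obtains f where "f \<in> finite_energy b" "f \<bullet>\<^sub>m (\<lambda>_. 1) = 0" "0 < f \<bullet>\<^sub>m f"
    "energy b f f = l * (f \<bullet>\<^sub>m f)"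
proof -
  obtain f where f: "f \<in> finite_energy b" "f \<noteq> (\<lambda>_. 0)"
    "\<And>h. h \<in> finite_energy b \<Longrightarrow> energy b f h = l * (f \<bullet>\<^sub>m h)"
    using assms(1) unfolding neumann_eigenvalues_eq by blast
  have "f \<bullet>\<^sub>m (\<lambda>_. 1) = 0"
    using f(3)[OF const_finite_energy[of 1]] assms(2) by (simp add: energy_const)
  with f show ?thesis
    using that inner_self_pos finite_energy_subset_ell2 by blast
qed

lemma eigenvalue_nonneg:
  assumes "l \<in> neumann_eigenvalues b (pmf m)"
  shows "0 \<le> l"
proof (cases "l = 0")
  case False
  then show ?thesis
    using nonzero_eigenvalueE[OF assms] energy_nonneg
    by (metis zero_le_mult_iff less_le_not_le)
qed simp

lemma is_second_lowest_eigenvalue_iff: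
  "is_second_lowest_eigenvalue b (pmf m) l \<longleftrightarrow> is_lowest (neumann_eigenvalues b (pmf m) - {0}) l"
proof -
  have "is_lowest (neumann_eigenvalues b (pmf m)) l0 \<longleftrightarrow> l0 = 0" for l0
    using zero_eigenvalue eigenvalue_nonneg unfolding is_lowest_def by (auto intro: antisym)
  then show ?thesis
    unfolding is_second_lowest_eigenvalue_def by simp
qed

lemma second_lowest_eigenvalue_eq:
  assumes "is_second_lowest_eigenvalue b (pmf m) l"
  shows "second_lowest_eigenvalue b (pmf m) = ereal l"
proof -
  have "(THE l. is_second_lowest_eigenvalue b (pmf m) l) = l"
    using assms unfolding is_second_lowest_eigenvalue_iff is_lowest_def
    by (intro the_equality) (auto intro: antisym)
  then show ?thesis
    using assms unfolding second_lowest_eigenvalue_def by auto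
qed

text \<open>Popoviciu's inequality with \<open>K = c * energy b f f\<close>. In product form the
  bound also covers \<open>c = 0\<close>, where it says that no nonzero eigenvalue exists.\<close>

lemma nonzero_eigenvalue_ge:
  assumes "l \<in> neumann_eigenvalues b (pmf m)" "l \<noteq> 0"
  shows "4 \<le> c * l"
proof -
  obtain f where f: "f \<in> finite_energy b" "f \<bullet>\<^sub>m (\<lambda>_. 1) = 0" "0 < f \<bullet>\<^sub>m f"
    "energy b f f = l * (f \<bullet>\<^sub>m f)"
    using nonzero_eigenvalueE[OF assms] .
  have "f \<bullet>\<^sub>m f \<le> c * energy b f f / 4"
    by (rule mean_zero_variance_le(2)[OF f(2)]) (rule poincare_ineq[OF f(1)])
  then have "4 * (f \<bullet>\<^sub>m f) \<le> (c * l) * (f \<bullet>\<^sub>m f)"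
    by (simp add: f(4))
  then show ?thesis
    using f(3) by (simp add: mult_le_cancel_right)
qed

section \<open>The second eigenvalue as the minimal Rayleigh quotient\<close>

text \<open>Subtraction of the mean, spelled as a linear combination so that the
  \<open>lincomb\<close> lemmas rewrite it directly.\<close>

definition center :: "('a \<Rightarrow> real) \<Rightarrow> 'a \<Rightarrow> real" where
  "center f = (\<lambda>x. 1 * f x + (- (f \<bullet>\<^sub>m (\<lambda>_. 1))) * 1)"

lemma
  assumes "f \<in> finite_energy b"
  shows center_finite_energy: "center f \<in> finite_energy b"
    and center_mean: "center f \<bullet>\<^sub>m (\<lambda>_. 1) = 0"
    and energy_center: "energy b (center f) (center f) = energy b f f"
proof -
  show "center f \<in> finite_energy b"
    unfolding center_def by (intro finite_energy_lincomb const_finite_energy assms)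
  show "center f \<bullet>\<^sub>m (\<lambda>_. 1) = 0"
    unfolding center_def
    by (subst ell2_inner_lincomb_left)
       (use assms in \<open>auto simp: inner_one_one finite_energy_subset_ell2 const_finite_energy\<close>)
  show "energy b (center f) (center f) = energy b f f"
    unfolding center_def
    by (subst energy_self_lincomb)
       (use assms in \<open>auto simp: energy_const const_finite_energy\<close>)
qed

text \<open>A minimising sequence of mean-zero functions is uniformly bounded by the Poincare
  inequality, so a subsequence converges pointwise, hence in \<open>ell2\<close> by dominated convergence.\<close>

lemma rayleigh_minimizer:
  assumes "f0 \<in> finite_energy b" "f0 x \<noteq> f0 y"
  obtains f where "f \<in> finite_energy b" "f \<bullet>\<^sub>m (\<lambda>_. 1) = 0" "f \<bullet>\<^sub>m f = 1"
    "\<And>g. g \<in> finite_energy b \<Longrightarrow> g \<bullet>\<^sub>m (\<lambda>_. 1) = 0 \<Longrightarrow> energy b f f * (g \<bullet>\<^sub>m g) \<le> energy b g g"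
proof -
  define S where "S = {f \<in> finite_energy b. f \<bullet>\<^sub>m (\<lambda>_. 1) = 0 \<and> f \<bullet>\<^sub>m f = 1}"
  define l where "l = (INF f\<in>S. energy b f f)"
  have bdd: "bdd_below ((\<lambda>f. energy b f f) ` S)"
    by (rule bdd_belowI[of _ 0]) (auto simp: energy_nonneg)
  \<comment> \<open>Scaling to norm one preserves mean zero and the Rayleigh quotient. It shows that
    \<open>S\<close> is nonempty and later extends the minimality from \<open>S\<close> to all
    mean-zero functions.\<close>
  have normalize: "\<exists>f\<in>S. energy b g g = energy b f f * (g \<bullet>\<^sub>m g)"
    if g: "g \<in> finite_energy b" "g \<bullet>\<^sub>m (\<lambda>_. 1) = 0" "g \<noteq> (\<lambda>_. 0)" for g
  proof -
    have pos: "0 < g \<bullet>\<^sub>m g"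
      using g inner_self_pos finite_energy_subset_ell2 by blast
    define r where "r = 1 / sqrt (g \<bullet>\<^sub>m g)"
    have r: "r\<^sup>2 * (g \<bullet>\<^sub>m g) = 1"
      using pos by (simp add: r_def power_divide)
    define f where "f = (\<lambda>x. r * g x + 0 * g x)"
    have 1: "f \<in> finite_energy b" unfolding f_def by (intro finite_energy_lincomb g)
    have 2: "f \<bullet>\<^sub>m (\<lambda>_. 1) = 0" "f \<bullet>\<^sub>m f = r\<^sup>2 * (g \<bullet>\<^sub>m g)"
      unfolding f_def using g
      by (subst ell2_inner_lincomb_left ell2_inner_self_lincomb;
          simp add: finite_energy_subset_ell2 const_finite_energy)+
    have 3: "energy b f f = r\<^sup>2 * energy b g g"
      unfolding f_def using g by (subst energy_self_lincomb) auto
    have "energy b f f * (g \<bullet>\<^sub>m g) = energy b g g * (r\<^sup>2 * (g \<bullet>\<^sub>m g))"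
      unfolding 3 by (simp add: mult_ac)
    with 1 2 r show ?thesis
      unfolding S_def by (intro bexI[of _ f]) auto
  qed
  have "center f0 \<noteq> (\<lambda>_. 0)"
    using assms(2) unfolding center_def fun_eq_iff by (metis add_right_cancel mult_1)
  then have "S \<noteq> {}"
    using normalize[OF center_finite_energy center_mean] assms(1) by blast
  have "\<exists>f. f \<in> S \<and> energy b f f < l + 1 / Suc n" for n
    using cInf_lessD[of "(\<lambda>f. energy b f f) ` S" "l + 1 / Suc n"] \<open>S \<noteq> {}\<close>
    by (force simp: l_def)
  then obtain F where F: "\<And>n. F n \<in> S" "\<And>n. energy b (F n) (F n) < l + 1 / Suc n"
    by metis
  have l_le: "l \<le> energy b f f" if "f \<in> S" for f
    unfolding l_def using bdd that by (rule cINF_lower)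
  have lim: "(\<lambda>n. energy b (F n) (F n)) \<longlonglongrightarrow> l"
  proof (rule tendsto_sandwich[of "\<lambda>_. l" _ _ "\<lambda>n. l + 1 / Suc n"])
    show "(\<lambda>n. l + 1 / Suc n) \<longlonglongrightarrow> l"
      using tendsto_add[OF tendsto_const LIMSEQ_inverse_real_of_nat] by (simp add: inverse_eq_divide)
  qed (use F l_le in \<open>auto intro!: always_eventually less_imp_le\<close>)
  \<comment> \<open>The square root comes from the mean-zero bound, with \<open>max c 0\<close>
    keeping the estimate monotone in the energy; the outer \<open>1\<close> covers the constant
    function in the limit of the means.\<close>
  define B where "B = max 1 (sqrt (max c 0 * (l + 1)))"
  have "\<bar>F n x\<bar> \<le> B" for n x
  proof -
    have "energy b (F n) (F n) \<le> l + 1 / Suc n" using F(2)[of n] by simp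
    also have "\<dots> \<le> l + 1" by simp
    finally have *: "energy b (F n) (F n) \<le> l + 1" .
    have "\<bar>F n x\<bar> \<le> sqrt (max c 0 * (l + 1))"
    proof (rule mean_zero_variance_le(1)[where p=m])
      fix x y
      have "(F n x - F n y)\<^sup>2 \<le> c * energy b (F n) (F n)"
        using F(1)[of n] by (intro poincare_ineq) (simp add: S_def)
      also have "\<dots> \<le> max c 0 * energy b (F n) (F n)"
        by (intro mult_right_mono energy_nonneg) auto
      also have "\<dots> \<le> max c 0 * (l + 1)"
        by (intro mult_left_mono *) auto
      finally show "(F n x - F n y)\<^sup>2 \<le> max c 0 * (l + 1)" .
    qed (use F(1)[of n] in \<open>simp add: S_def\<close>)
    then show ?thesis by (simp add: B_def)
  qed
  note FB = this
  obtain f r where r: "strict_mono r" and f: "\<And>x. (\<lambda>n. F (r n) x) \<longlonglongrightarrow> f x"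
    by (rule bounded_seq_pointwise_subseq[of F B, OF FB]) (rule that)
  have lim_r: "(\<lambda>n. energy b (F (r n)) (F (r n))) \<longlonglongrightarrow> l"
    using LIMSEQ_subseq_LIMSEQ[OF lim r] by (simp add: o_def)
  have FS: "F (r n) \<in> finite_energy b" for n using F(1)[of "r n"] by (simp add: S_def)
  \<comment> \<open>The energy is only lower semicontinuous, which suffices since \<open>l\<close>
    is an infimum; mean and norm, by contrast, must converge for \<open>f\<close> to satisfy the
    constraints.\<close>
  have fE: "f \<in> finite_energy b" "energy b f f \<le> l"
    using energy_fatou[OF FS f lim_r] by blast+
  have "(\<lambda>n. F (r n) \<bullet>\<^sub>m (\<lambda>_. 1)) \<longlonglongrightarrow> f \<bullet>\<^sub>m (\<lambda>_. 1)"
    by (rule ell2_inner_pmf_tendsto[where B=B]) (auto simp: FB f, simp add: B_def)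
  moreover have "F (r n) \<bullet>\<^sub>m (\<lambda>_. 1) = 0" for n using F(1)[of "r n"] by (simp add: S_def)
  ultimately have f1: "f \<bullet>\<^sub>m (\<lambda>_. 1) = 0"
    by (auto simp: LIMSEQ_const_iff)
  have "(\<lambda>n. F (r n) \<bullet>\<^sub>m F (r n)) \<longlonglongrightarrow> f \<bullet>\<^sub>m f"
    by (rule ell2_inner_pmf_tendsto[where B=B]) (auto simp: FB f)
  moreover have "F (r n) \<bullet>\<^sub>m F (r n) = 1" for n using F(1)[of "r n"] by (simp add: S_def)
  ultimately have f2: "f \<bullet>\<^sub>m f = 1"
    by (auto simp: LIMSEQ_const_iff)
  show thesis
  proof (rule that[OF fE(1) f1 f2])
    fix g assume g: "g \<in> finite_energy b" "g \<bullet>\<^sub>m (\<lambda>_. 1) = 0"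
    show "energy b f f * (g \<bullet>\<^sub>m g) \<le> energy b g g"
    proof (cases "g = (\<lambda>_. 0)")
      case True
      then show ?thesis by (simp add: energy_const ell2_inner_def)
    next
      case False
      then obtain f' where f': "f' \<in> S" "energy b g g = energy b f' f' * (g \<bullet>\<^sub>m g)"
        using normalize g by blast
      have "energy b f f \<le> energy b f' f'" using fE(2) l_le[OF f'(1)] by simp
      then show ?thesis
        unfolding f'(2) by (intro mult_right_mono ell2_inner_self_nonneg) auto
    qed
  qed
qed

text \<open>The minimiser satisfies the Euler-Lagrange equation, so its energy is an eigenvalue.
  Every nonzero eigenvalue is the Rayleigh quotient of a mean-zero function and hence no
  smaller.\<close>

lemma second_lowest_eigenvalue_rayleigh:
  assumes "f0 \<in> finite_energy b" "f0 x \<noteq> f0 y"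
  obtains l where "is_second_lowest_eigenvalue b (pmf m) l"
    "\<And>g. g \<in> finite_energy b \<Longrightarrow> g \<bullet>\<^sub>m (\<lambda>_. 1) = 0 \<Longrightarrow> l * (g \<bullet>\<^sub>m g) \<le> energy b g g"
proof -
  obtain f where f: "f \<in> finite_energy b" "f \<bullet>\<^sub>m (\<lambda>_. 1) = 0" "f \<bullet>\<^sub>m f = 1"
    and min: "\<And>g. g \<in> finite_energy b \<Longrightarrow> g \<bullet>\<^sub>m (\<lambda>_. 1) = 0 \<Longrightarrow> energy b f f * (g \<bullet>\<^sub>m g) \<le> energy b g g"
    using rayleigh_minimizer[OF assms] by blast
  define l where "l = energy b f f"
  note E = finite_energy_subset_ell2 const_finite_energy
  have EL: "energy b f h = l * (f \<bullet>\<^sub>m h)" if h: "h \<in> finite_energy b" for h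
  proof -
    \<comment> \<open>Minimality can be tested in mean-zero directions only. Replacing
      \<open>h\<close> by \<open>k\<close> changes neither side, since \<open>f\<close> has mean
      zero and the energy ignores constants.\<close>
    define k where "k = center h"
    have k: "k \<in> finite_energy b" "k \<bullet>\<^sub>m (\<lambda>_. 1) = 0"
      unfolding k_def using center_finite_energy center_mean h by auto
    have "energy b f k - l * (f \<bullet>\<^sub>m k) = 0"
    proof (rule linear_coefficient_eq_0)
      fix t :: real
      define g where "g = (\<lambda>x. 1 * f x + t * k x)"
      have "g \<in> finite_energy b" unfolding g_def using f k by (intro finite_energy_lincomb)
      moreover have "g \<bullet>\<^sub>m (\<lambda>_. 1) = 0"
        unfolding g_def using f k by (subst ell2_inner_lincomb_left) (auto simp: E)
      ultimately have "l * (g \<bullet>\<^sub>m g) \<le> energy b g g" unfolding l_def by (rule min)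
      moreover have "g \<bullet>\<^sub>m g = 1 + 2 * t * (f \<bullet>\<^sub>m k) + t\<^sup>2 * (k \<bullet>\<^sub>m k)"
        unfolding g_def using f k by (subst ell2_inner_self_lincomb) (auto simp: E)
      moreover have "energy b g g = l + 2 * t * energy b f k + t\<^sup>2 * energy b k k"
        unfolding g_def l_def using f k by (subst energy_self_lincomb) auto
      ultimately show "0 \<le> 2 * t * (energy b f k - l * (f \<bullet>\<^sub>m k)) + t\<^sup>2 * (energy b k k - l * (k \<bullet>\<^sub>m k))"
        by (simp add: algebra_simps)
    qed
    moreover have "f \<bullet>\<^sub>m k = f \<bullet>\<^sub>m h"
      unfolding k_def center_def using f h by (subst ell2_inner_lincomb_right) (auto simp: E)
    moreover have "energy b f k = energy b f h"
      by (simp add: energy_eq k_def center_def coboundary_def)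
    ultimately show ?thesis by simp
  qed
  have "f \<noteq> (\<lambda>_. 0)" using f(3) by (auto simp: ell2_inner_def)
  then have l: "l \<in> neumann_eigenvalues b (pmf m)"
    unfolding neumann_eigenvalues_eq using f(1) EL by blast
  have "l \<noteq> 0"
  proof
    assume "l = 0"
    \<comment> \<open>A function of zero energy is constant, and a constant of mean zero cannot have
      norm one.\<close>
    then have "f = (\<lambda>_. f undefined)" using energy_eq_0D[OF f(1)] unfolding l_def by blast
    then show False
      using f(2,3) inner_const_left by (metis ell2_inner_commute mult_zero_right zero_neq_one)
  qed
  have "l \<le> k" if "k \<in> neumann_eigenvalues b (pmf m)" "k \<noteq> 0" for k
  proof -
    obtain g where g: "g \<in> finite_energy b" "g \<bullet>\<^sub>m (\<lambda>_. 1) = 0" "0 < g \<bullet>\<^sub>m g"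
      "energy b g g = k * (g \<bullet>\<^sub>m g)"
      using nonzero_eigenvalueE[OF \<open>k \<in> _\<close> \<open>k \<noteq> 0\<close>] .
    have "l * (g \<bullet>\<^sub>m g) \<le> k * (g \<bullet>\<^sub>m g)" using min[OF g(1,2)] g(4) by (simp add: l_def)
    then show ?thesis using g(3) by (simp add: mult_le_cancel_right)
  qed
  then have "is_second_lowest_eigenvalue b (pmf m) l"
    unfolding is_second_lowest_eigenvalue_iff is_lowest_def using l \<open>l \<noteq> 0\<close> by blast
  then show thesis using that min unfolding l_def by blast
qed

section \<open>Estimates relating the second eigenvalue and the Poincare constant\<close>

lemma second_lowest_eigenvalue_ge:
  assumes "0 < c"
  shows "ereal (4 / c) \<le> second_lowest_eigenvalue b (pmf m)"
proof (cases "\<exists>l. is_second_lowest_eigenvalue b (pmf m) l")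
  case True
  then obtain l where l: "is_second_lowest_eigenvalue b (pmf m) l" by blast
  then have "4 \<le> c * l"
    unfolding is_second_lowest_eigenvalue_iff is_lowest_def
    using nonzero_eigenvalue_ge by blast
  then show ?thesis
    unfolding second_lowest_eigenvalue_eq[OF l] using assms by (simp add: field_simps)
next
  case False
  then show ?thesis by (simp add: second_lowest_eigenvalue_def)
qed

text \<open>A partial converse to Popoviciu's inequality: two points of mass at least
  \<open>q\<close> each already force the variance of \<open>f\<close> to be at least
  \<open>q * (f x - f y)\<^sup>2 / 2\<close>. If the two values differ, a second eigenvalue exists
  and its Rayleigh bound applies to the centred function.\<close>

lemma second_lowest_eigenvalue_two_point_bound:
  assumes "f \<in> finite_energy b" "q \<le> pmf m x" "q \<le> pmf m y" "x \<noteq> y" "0 \<le> q" "0 \<le> l"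
    and l: "ereal l \<le> second_lowest_eigenvalue b (pmf m)"
  shows "l * q * (f x - f y)\<^sup>2 \<le> 2 * energy b f f"
proof (cases "f x = f y")
  case True
  then show ?thesis by (simp add: energy_nonneg)
next
  case False
  obtain l2 where l2: "is_second_lowest_eigenvalue b (pmf m) l2"
    "\<And>g. g \<in> finite_energy b \<Longrightarrow> g \<bullet>\<^sub>m (\<lambda>_. 1) = 0 \<Longrightarrow> l2 * (g \<bullet>\<^sub>m g) \<le> energy b g g"
    using second_lowest_eigenvalue_rayleigh[OF assms(1) False] by blast
  have "l \<le> l2" using l second_lowest_eigenvalue_eq[OF l2(1)] by simp
  define g where "g = center f"
  have g: "g \<in> finite_energy b" "g \<bullet>\<^sub>m (\<lambda>_. 1) = 0" "energy b g g = energy b f f"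
    unfolding g_def using center_finite_energy center_mean energy_center assms(1) by auto
  have "q * (f x - f y)\<^sup>2 = q * (g x - g y)\<^sup>2" by (simp add: g_def center_def)
  \<comment> \<open>The two sides differ by \<open>q * (g x + g y)\<^sup>2\<close>, so nothing is
    lost when the two values are opposite.\<close>
  also have "\<dots> \<le> q * (2 * ((g x)\<^sup>2 + (g y)\<^sup>2))"
    using assms(5) zero_le_power2[of "g x + g y"]
    by (intro mult_left_mono) (simp_all add: power2_eq_square algebra_simps)
  also have "\<dots> \<le> 2 * ((g x)\<^sup>2 * pmf m x + (g y)\<^sup>2 * pmf m y)"
    using mult_right_mono[OF assms(2), of "(g x)\<^sup>2"] mult_right_mono[OF assms(3), of "(g y)\<^sup>2"]
    by (simp add: algebra_simps)
  also have "\<dots> \<le> 2 * (g \<bullet>\<^sub>m g)"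
    using ell2_inner_self_ge[of "pmf m" g "{x, y}"] g(1) assms(4)
    by (simp add: finite_energy_subset_ell2)
  finally have *: "q * (f x - f y)\<^sup>2 \<le> 2 * (g \<bullet>\<^sub>m g)" .
  have "l * q * (f x - f y)\<^sup>2 \<le> 2 * (l * (g \<bullet>\<^sub>m g))"
    using mult_left_mono[OF * assms(6)] by (simp add: mult_ac)
  also have "\<dots> \<le> 2 * (l2 * (g \<bullet>\<^sub>m g))"
    using \<open>l \<le> l2\<close> by (simp add: mult_right_mono ell2_inner_self_nonneg)
  also have "\<dots> \<le> 2 * energy b f f" using l2(2)[OF g(1,2)] g(3) by simp
  finally show ?thesis .
qed

end

subsection \<open>The best constant\<close>

text \<open>The infimum is attained: for fixed \<open>f\<close> and a pair of points, admissibility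
  is a lower bound on the constant after division by the energy. When the energy vanishes, any
  admissible constant already gives the claim.\<close>

lemma global_poincare_poincare_constant:
  assumes "global_poincare b c" "0 \<le> c" "\<And>x y. 0 \<le> b x y"
  shows "global_poincare b (poincare_constant b)" and "0 \<le> poincare_constant b"
proof -
  define S where "S = {c. 0 \<le> c \<and> global_poincare b c}"
  have S: "S \<noteq> {}" using assms by (auto simp: S_def)
  have P: "poincare_constant b = Inf S" by (simp add: poincare_constant_def S_def)
  show "0 \<le> poincare_constant b"
    unfolding P by (rule cInf_greatest[OF S]) (simp add: S_def)
  show "global_poincare b (poincare_constant b)"
    unfolding global_poincare_iff
  proof (intro ballI allI)
    fix f x y assume f: "f \<in> finite_energy b"
    have le: "(f x - f y)\<^sup>2 \<le> k * energy b f f" if "k \<in> S" for k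
      using that f unfolding S_def global_poincare_iff by blast
    have E: "0 \<le> energy b f f"
      using assms(3) by (simp add: energy_eq ell2_inner_self_nonneg case_prod_beta)
    show "(f x - f y)\<^sup>2 \<le> poincare_constant b * energy b f f"
    proof (cases "energy b f f = 0")
      case True
      then show ?thesis using le S by auto
    next
      case False
      then have "(f x - f y)\<^sup>2 / energy b f f \<le> Inf S"
        using le E S by (intro cInf_greatest) (auto simp: field_simps)
      then show ?thesis using False E by (simp add: P field_simps)
    qed
  qed
qed

theorem theorem3p6:
  fixes b :: "'a::countable \<Rightarrow> 'a \<Rightarrow> real"
  assumes "weighted_graph b"
    and "connected_graph b"
    and "\<exists>c>0. global_poincare b c"
  shows "global_poincare b (poincare_constant b) \<and>
    4 / ereal (poincare_constant b) =
      (INF m\<in>{m :: 'a pmf. set_pmf m = UNIV}. second_lowest_eigenvalue b (pmf m))"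
proof -
  have nonneg: "\<And>x y. 0 \<le> b x y" using assms(1) by (simp add: weighted_graph_def)
  define C where "C = poincare_constant b"
  have C: "global_poincare b C" "0 \<le> C"
    using global_poincare_poincare_constant[of b] assms(3) nonneg unfolding C_def
    by (meson less_imp_le)+
  interpret poincare_graph b C
    using nonneg C by unfold_locales
  define I where "I = (INF m\<in>{m :: 'a pmf. set_pmf m = UNIV}. second_lowest_eigenvalue b (pmf m))"
  have I_le: "I \<le> second_lowest_eigenvalue b (pmf m)" if "set_pmf m = UNIV" for m
    unfolding I_def using that by (auto intro: INF_lower)
  \<comment> \<open>The converse direction: a positive lower bound \<open>l\<close> on all second
    eigenvalues makes \<open>4 / l\<close> an admissible constant. Working pair by pair removes any
    need to choose nearly extremal points.\<close>
  have C_le: "C \<le> 4 / l" if l: "0 < l" "ereal l \<le> I" for l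
  proof -
    have "(f x - f y)\<^sup>2 \<le> 4 / l * energy b f f" if f: "f \<in> finite_energy b" for f x y
    proof (cases "x = y")
      case True
      then show ?thesis using energy_nonneg l by simp
    next
      case False
      have bound: "(1 - e) * (l * (f x - f y)\<^sup>2) \<le> 4 * energy b f f" if e: "0 < e" "e < 1" for e
      proof -
        obtain m where m: "set_pmf m = UNIV" "(1 - e) / 2 \<le> pmf m x" "(1 - e) / 2 \<le> pmf m y"
          using exists_full_support_pmf_near_two_points[OF e False] .
        interpret poincare_graph_measure b C m
          using m(1) by unfold_locales
        \<comment> \<open>Here \<open>q = (1 - e) / 2\<close>; this half and the factor
          \<open>2\<close> on the right combine into the constant \<open>4\<close>.\<close>
        have "l * ((1 - e) / 2) * (f x - f y)\<^sup>2 \<le> 2 * energy b f f"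
          using l e I_le[OF m(1)] f m False
          by (intro second_lowest_eigenvalue_two_point_bound) auto
        then show ?thesis by (simp add: field_simps)
      qed
      \<comment> \<open>The measure depends on \<open>e\<close> but the two sides of the bound do
        not involve it, so \<open>e\<close> can tend to \<open>0\<close>.\<close>
      have "((\<lambda>e. (1 - e) * (l * (f x - f y)\<^sup>2)) \<longlongrightarrow> (1 - 0) * (l * (f x - f y)\<^sup>2)) (at_right 0)"
        by (intro tendsto_intros)
      moreover have "eventually (\<lambda>e. (1 - e) * (l * (f x - f y)\<^sup>2) \<le> 4 * energy b f f) (at_right 0)"
        using eventually_at_right_less[of 0] eventually_at_right_real[of 0 1]
        by (auto elim!: eventually_mono intro: bound)
      ultimately have "(1 - 0) * (l * (f x - f y)\<^sup>2) \<le> 4 * energy b f f"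
        by (rule tendsto_upperbound) simp
      then show ?thesis using l by (simp add: field_simps)
    qed
    then have "global_poincare b (4 / l)" unfolding global_poincare_iff by blast
    then show ?thesis
      unfolding C_def poincare_constant_def using l
      by (intro cInf_lower) (auto intro!: bdd_belowI[of _ 0])
  qed
  have "4 / ereal C = I"
  proof (rule antisym)
    show "4 / ereal C \<le> I"
    proof (cases "C = 0")
      case True
      \<comment> \<open>In \<open>ereal\<close>, \<open>4 / 0\<close> is infinite, so every second
        eigenvalue must take the default value; indeed \<open>4 <= 0 * l\<close> rules out nonzero
        eigenvalues.\<close>
      have "second_lowest_eigenvalue b (pmf m) = \<infinity>" if "set_pmf m = UNIV" for m
      proof -
        interpret poincare_graph_measure b C m
          using that by unfold_locales
        show ?thesis
          using nonzero_eigenvalue_ge True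
          by (auto simp: second_lowest_eigenvalue_def is_second_lowest_eigenvalue_iff is_lowest_def)
      qed
      then show ?thesis unfolding I_def by (intro INF_greatest) simp
    next
      case False
      show ?thesis unfolding I_def
      proof (rule INF_greatest)
        fix m :: "'a pmf" assume "m \<in> {m. set_pmf m = UNIV}"
        then interpret poincare_graph_measure b C m by unfold_locales simp
        show "4 / ereal C \<le> second_lowest_eigenvalue b (pmf m)"
          using second_lowest_eigenvalue_ge C False by simp
      qed
    qed
    show "I \<le> 4 / ereal C"
    proof (cases "0 < I")
      case False
      moreover have "0 \<le> 4 / ereal C"
        using C(2) by (cases "C = 0") auto
      ultimately show ?thesis by simp
    next
      case pos: True
      show ?thesis
      proof (cases "C = 0")
        case True
        then show ?thesis by simp
      next
        case False
        then have "0 < C" using C(2) by simp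
        show ?thesis
        proof (cases I)
          case (real l)
          then have "C \<le> 4 / l" using pos by (intro C_le) auto
          then show ?thesis using real pos \<open>0 < C\<close> by (simp add: field_simps)
        next
          case PInf
          \<comment> \<open>Any finite \<open>l\<close> is now a lower bound; \<open>8 / C\<close>
            gives \<open>C <= C / 2\<close>, contradicting \<open>0 < C\<close>.\<close>
          then have "C \<le> 4 / (8 / C)" using \<open>0 < C\<close> by (intro C_le) auto
          then show ?thesis using \<open>0 < C\<close> by simp
        next
          case MInf
          then show ?thesis using pos by simp
        qed
      qed
    qed
  qed
  with C(1) show ?thesis unfolding C_def I_def by simp
qed

end
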